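(* Let $\mathcal{D}_h,\mathcal{D}_l$ be NDBATs, $m$ an NDBAT refinement mapping from $\mathcal{D}_h$ to $\mathcal{D}_l$ proper wrt $\mathcal{D}_l$, $M_h\models\mathcal{D}_h\cup\mathcal{C}$, $M_l\models\mathcal{D}_l\cup\mathcal{C}$, and suppose $M_h\sim_m M_l$. Then for any sequence $\vec\alpha$ of high-level agent actions, any high-level situation-suppressed formula $\phi$ and any variable assignment $v$: $M_l,v\models\exists s'.Do_{ag}(m_a(\vec\alpha),S_0,s')\wedge m_f(\phi)[s']$ if and only if $M_h,v\models\exists s'.Do_{ag}(\vec\alpha,S_0,s')\wedge\phi[s']$.
   Context: Framework: the situation calculus. Situations: $S_0$ and $do(a,s)$. $Executable(s)$ means every action performed in reaching $s$ was possible when performed. A situation-suppressed formula has situation arguments of fluents removed; $\phi[s]$ restores $s$. $M,v\models\phi$: model $M$ and variable assignment $v$ satisfy $\phi$; $v[x/d]$ is $v$ modified at $x$. $\vec\alpha$ may contain free variables in action parameters, but its action function symbols are given. NDBAT: a basic action theory (foundational axioms, initial-state axioms, unique-name axioms for actions, successor state axioms, precondition axioms $Poss(A(\vec x,e),s)\equiv\phi^{Poss}_A(\vec x,e,s)$) in which every action function $A(\vec x,e)$ has a final argument $e$ of sort Reaction. $A(\vec x,e)$ is a system action, $A(\vec x)$ the agent action, with agent precondition $Poss_{ag}(A(\vec x),s)$; the theory entails $\forall e.Poss(A(\vec x,e),s)\supset Poss_{ag}(A(\vec x),s)$ and $Poss_{ag}(A(\vec x),s)\supset\exists e.Poss(A(\vec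 x,e),s)$. For a sequence of agent actions: $Do_{ag}(\epsilon,s,s')\doteq s'=s$, $Do_{ag}([A(\vec x),\sigma],s,s')\doteq\exists e.Poss(A(\vec x,e),s)\wedge Do_{ag}(\sigma,do(A(\vec x,e),s),s')$. ConGolog programs $\delta::=\alpha\mid\varphi?\mid\delta_1;\delta_2\mid\delta_1|\delta_2\mid\pi x.\delta\mid\delta^*\mid\delta_1\|\delta_2$ ($nil=True?$). $\mathcal{C}$ axiomatizes $Trans,Final$: $Trans(\alpha,s,\delta',s')\equiv s'=do(\alpha,s)\wedge Poss(\alpha,s)\wedge\delta'=True?$; $Trans(\varphi?,s,\delta',s')\equiv False$; $Trans(\delta_1;\delta_2,s,\delta',s')\equiv(Trans(\delta_1,s,\delta_1',s')\wedge\delta'=\delta_1';\delta_2)\vee(Final(\delta_1,s)\wedge Trans(\delta_2,s,\delta',s'))$; choice: disjunction; $\pi$: existential; $Trans(\delta^*,s,\delta',s')\equiv Trans(\delta,s,\delta'',s')\wedge\delta'=\delta'';\delta^*$; $\|$: interleaving. $Final(\alpha,s)\equiv False$, $Final(\varphi?,s)\equiv\varphi[s]$, sequence and $\|$: conjunction, choice: disjunction, $\pi$: existential, $Final(\delta^*,s)\equiv True$. $Do(\delta,s,s')\doteq\exists\delta'.Trans^*(\delta,s,\delta',s')\wedge Final(\delta',s')$. Agent programs (atoms are agent actions) use $Trans(A(\vec x),s,\delta',s')\equiv\exists e.Poss(A(\vec x,e),s)\wedge\delta'=True?\wedge s'=do(A(\vec x,e),s)$; $Do_{ag}(\delta,s,s')$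 is $Do$ under this semantics (agreeing with the sequence definition above). SD: $Trans^*(\delta,s,\delta',s')\wedge Trans^*(\delta,s,\delta'',s')\supset\delta'=\delta''$. Abstraction setting: high-level NDBAT $\mathcal{D}_h$ (finite action types $\mathcal{A}_h$, fluents $\mathcal{F}_h$), low-level NDBAT $\mathcal{D}_l$, sharing only a countably infinite set of standard object names (unique names, domain closure; Reaction a subsort of Object); no functions other than constants, no non-fluent predicates. A refinement mapping $m=\langle m_a,m_s,m_f\rangle$ maps each $A\in\mathcal{A}_h$ to an SD low-level agent program $m_a(A(\vec x))$ and an SD low-level system program $m_s(A(\vec x,e))$, and each high-level fluent $F(\vec x)$ to a situation-suppressed low-level formula $m_f(F(\vec x))$; extended to sequences by composition with ";" ($m(\epsilon)=nil$), and to formulas by replacing fluents by their images. Proper wrt $\mathcal{D}_l$: for all high-level system action sequences $\vec\alpha$ and $A$, $\mathcal{D}_l\cup\mathcal{C}\models\forall s.(Do(m_s(\vec\alpha),S_0,s)\supset\forall\vec x,s'.(Do_{ag}(m_a(A(\vec x)),s,s')\equiv\exists e.Do(m_s(A(\vec x,e)),s,s')))$. $s_h\sim_m^{M_h,M_l}s_l$ iff for every $F\in\mathcal{F}_h$ and assignment $v$: $M_h,v[s/s_h]\models F(\vec x,s)$ iff $M_l,v[s/s_l]\models m_f(F(\vec x))[s]$. An $m$-bisimulation $B$ satisfies, for $\langle s_h,s_l\rangle\in B$: (i) $s_h\sim_m^{M_h,M_l}s_l$; (ii) for each $A\in\mathcal{A}_h$, if $M_h,v[s/s_h,s'/s_h']\models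 Poss(A(\vec x,e),s)\wedge s'=do(A(\vec x,e),s)$ then some $s_l'$ has $M_l,v[s/s_l,s'/s_l']\models Do(m_s(A(\vec x,e)),s,s')$ and $\langle s_h',s_l'\rangle\in B$; (iii) conversely from $Do(m_s(A(\vec x,e)),s_l,s_l')$ to some $s_h'=do(A(\vec x,e),s_h)$ with $Poss$ and $\langle s_h',s_l'\rangle\in B$. $M_h\sim_m M_l$ iff some $m$-bisimulation relates $S_0^{M_h}$ and $S_0^{M_l}$. *)

theory Defs
  imports Main "HOL-Library.Countable" "HOL-Library.Infinite_Typeclass"
begin

section \<open>Standard names and terms\<close>

text \<open>
  The object domain of every structure is the type \<open>'n\<close> of standard names itself, which builds in
  unique names and domain closure for objects; \<open>reactions\<close> is the set of names of the subsort
  Reaction. Both are shared by all theories over the same \<open>'n\<close>.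
\<close>

class standard_names = countable + infinite +
  fixes reactions :: "'a set"
  assumes reactions_nonempty: "reactions \<noteq> {}"

datatype srt = Object | Reaction

primrec dom_of :: "srt \<Rightarrow> 'n::standard_names set" where
  "dom_of Object = UNIV"
| "dom_of Reaction = reactions"

text \<open>
  Variables are de Bruijn indices, with a separate index space for each sort. An operator binding
  a variable of sort \<open>k\<close> binds \<open>Var k 0\<close> in its body and shifts the other variables of sort \<open>k\<close>.
\<close>

datatype 'n tm = Var srt nat | Cst 'n

type_synonym 'n asg = "srt \<Rightarrow> nat \<Rightarrow> 'n"

definition assignment :: "'n::standard_names asg \<Rightarrow> bool" where
  "assignment v \<longleftrightarrow> (\<forall>k i. v k i \<in> dom_of k)"

text \<open>\<open>push k d v\<close> is the assignment \<open>v[x/d]\<close> for the innermost bound variable \<open>x\<close> of sort \<open>k\<close>.\<close>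

definition push :: "srt \<Rightarrow> 'n \<Rightarrow> 'n asg \<Rightarrow> 'n asg" where
  "push k d v = v(k := case_nat d (v k))"

primrec val :: "'n asg \<Rightarrow> 'n tm \<Rightarrow> 'n" where
  "val v (Var k i) = v k i"
| "val v (Cst c) = c"

primrec of_sort :: "srt \<Rightarrow> 'n::standard_names tm \<Rightarrow> bool" where
  "of_sort k (Var k' i) \<longleftrightarrow> k = Object \<or> k' = Reaction"
| "of_sort k (Cst c) \<longleftrightarrow> c \<in> dom_of k"

type_synonym ctx = "srt \<Rightarrow> nat"

text \<open>\<open>tm_in n t\<close>: the variables of \<open>t\<close> are among the first \<open>n k\<close> ones of each sort \<open>k\<close>.\<close>

primrec tm_in :: "ctx \<Rightarrow> 'n tm \<Rightarrow> bool" where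
  "tm_in n (Var k i) \<longleftrightarrow> i < n k"
| "tm_in n (Cst c) \<longleftrightarrow> True"

definition ctx :: "nat \<Rightarrow> nat \<Rightarrow> ctx" where
  "ctx p q = (\<lambda>k. case k of Object \<Rightarrow> p | Reaction \<Rightarrow> q)"

text \<open>
  Conventions for formal parameters: in anything attached to a symbol with parameters \<open>x\<^sub>1, \<dots>, x\<^sub>p\<close>
  these are \<open>Var Object 0, \<dots>, Var Object (p - 1)\<close>, and the reaction parameter \<open>e\<close> of an action
  function is \<open>Var Reaction 0\<close>.
\<close>

definition xs_of :: "nat \<Rightarrow> 'n tm list" where
  "xs_of p = map (Var Object) [0..<p]"

definition e_of :: "'n tm" where
  "e_of = Var Reaction 0"

type_synonym 'n sub = "srt \<Rightarrow> nat \<Rightarrow> 'n tm"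

primrec tsubst :: "'n sub \<Rightarrow> 'n tm \<Rightarrow> 'n tm" where
  "tsubst \<sigma> (Var k i) = \<sigma> k i"
| "tsubst \<sigma> (Cst c) = Cst c"

definition shift :: "srt \<Rightarrow> 'n tm \<Rightarrow> 'n tm" where
  "shift k = tsubst (Var(k := (\<lambda>i. Var k (Suc i))))"

definition lift :: "srt \<Rightarrow> 'n sub \<Rightarrow> 'n sub" where
  "lift k \<sigma> = (let \<tau> = (\<lambda>k' i. shift k (\<sigma> k' i)) in \<tau>(k := case_nat (Var k 0) (\<tau> k)))"

definition inst :: "srt \<Rightarrow> 'n \<Rightarrow> 'n sub" where
  "inst k d = Var(k := case_nat (Cst d) (Var k))"

definition args :: "'n tm list \<Rightarrow> 'n tm list \<Rightarrow> 'n sub" where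
  "args ts rs k i =
     (let us = (case k of Object \<Rightarrow> ts | Reaction \<Rightarrow> rs) in if i < length us then us ! i else Var k i)"


section \<open>Formulas\<close>

text \<open>Situation-suppressed formulas.\<close>

datatype ('n, 'F) fm =
    Tr
  | Fl 'F "'n tm list"
  | Eq "'n tm" "'n tm"
  | Neg "('n, 'F) fm"
  | Con "('n, 'F) fm" "('n, 'F) fm"
  | Exi srt "('n, 'F) fm"

primrec fsubst :: "('n, 'F) fm \<Rightarrow> 'n sub \<Rightarrow> ('n, 'F) fm" where
  "fsubst Tr \<sigma> = Tr"
| "fsubst (Fl F ts) \<sigma> = Fl F (map (tsubst \<sigma>) ts)"
| "fsubst (Eq t u) \<sigma> = Eq (tsubst \<sigma> t) (tsubst \<sigma> u)"
| "fsubst (Neg \<phi>) \<sigma> = Neg (fsubst \<phi> \<sigma>)"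
| "fsubst (Con \<phi> \<psi>) \<sigma> = Con (fsubst \<phi> \<sigma>) (fsubst \<psi> \<sigma>)"
| "fsubst (Exi k \<phi>) \<sigma> = Exi k (fsubst \<phi> (lift k \<sigma>))"

text \<open>
  Formulas uniform in a situation, as used in the axioms of an action theory: in addition to fluents
  and objects they may speak about actions. Action variables are de Bruijn indices of their own.
\<close>

datatype ('n, 'A) atm = AVar nat | Act 'A "'n tm list" "'n tm"

datatype ('n, 'F, 'A) ufm =
    Sup "('n, 'F) fm"
  | AEq "('n, 'A) atm" "('n, 'A) atm"
  | UNeg "('n, 'F, 'A) ufm"
  | UCon "('n, 'F, 'A) ufm" "('n, 'F, 'A) ufm"
  | UEx srt "('n, 'F, 'A) ufm"
  | UExA "('n, 'F, 'A) ufm"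


section \<open>Structures\<close>

text \<open>
  The action and situation domains are the types \<open>'a\<close> and \<open>'s\<close>. Values of \<open>actf\<close> and \<open>flu\<close> on
  argument lists of the wrong length, or with a last argument of \<open>actf\<close> that is not a reaction, are
  never referred to.
\<close>

record ('n, 'F, 'A, 'a, 's) struct =
  actf :: "'A \<Rightarrow> 'n list \<Rightarrow> 'n \<Rightarrow> 'a"
  S0 :: 's
  doo :: "'a \<Rightarrow> 's \<Rightarrow> 's"
  prec :: "'s \<Rightarrow> 's \<Rightarrow> bool"
  poss :: "'a \<Rightarrow> 's \<Rightarrow> bool"
  flu :: "'F \<Rightarrow> 'n list \<Rightarrow> 's \<Rightarrow> bool"

text \<open>\<open>sat M v s \<phi>\<close> is \<open>M,v \<Turnstile> \<phi>[s]\<close>.\<close>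

primrec sat ::
  "('n::standard_names, 'F, 'A, 'a, 's) struct \<Rightarrow> 'n asg \<Rightarrow> 's \<Rightarrow> ('n, 'F) fm \<Rightarrow> bool" where
  "sat M v s Tr \<longleftrightarrow> True"
| "sat M v s (Fl F ts) \<longleftrightarrow> flu M F (map (val v) ts) s"
| "sat M v s (Eq t u) \<longleftrightarrow> val v t = val v u"
| "sat M v s (Neg \<phi>) \<longleftrightarrow> \<not> sat M v s \<phi>"
| "sat M v s (Con \<phi> \<psi>) \<longleftrightarrow> sat M v s \<phi> \<and> sat M v s \<psi>"
| "sat M v s (Exi k \<phi>) \<longleftrightarrow> (\<exists>d\<in>dom_of k. sat M (push k d v) s \<phi>)"

primrec aval ::
  "('n, 'F, 'A, 'a, 's) struct \<Rightarrow> 'n asg \<Rightarrow> (nat \<Rightarrow> 'a) \<Rightarrow> ('n, 'A) atm \<Rightarrow> 'a" where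
  "aval M v w (AVar i) = w i"
| "aval M v w (Act A ts t) = actf M A (map (val v) ts) (val v t)"

primrec usat ::
  "('n::standard_names, 'F, 'A, 'a, 's) struct \<Rightarrow> 'n asg \<Rightarrow> (nat \<Rightarrow> 'a) \<Rightarrow> 's
     \<Rightarrow> ('n, 'F, 'A) ufm \<Rightarrow> bool" where
  "usat M v w s (Sup \<phi>) \<longleftrightarrow> sat M v s \<phi>"
| "usat M v w s (AEq a b) \<longleftrightarrow> aval M v w a = aval M v w b"
| "usat M v w s (UNeg \<Phi>) \<longleftrightarrow> \<not> usat M v w s \<Phi>"
| "usat M v w s (UCon \<Phi> \<Psi>) \<longleftrightarrow> usat M v w s \<Phi> \<and> usat M v w s \<Psi>"
| "usat M v w s (UEx k \<Phi>) \<longleftrightarrow> (\<exists>d\<in>dom_of k. usat M (push k d v) w s \<Phi>)"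
| "usat M v w s (UExA \<Phi>) \<longleftrightarrow> (\<exists>a. usat M v (case_nat a w) s \<Phi>)"


section \<open>Nondeterministic basic action theories\<close>

text \<open>
  \<open>aar A\<close> is the number of parameters of \<open>A\<close> other than the reaction; \<open>ssa F\<close>, \<open>pre A\<close> and
  \<open>agpre A\<close> are the right-hand sides of the successor state axiom of \<open>F\<close> (with the action in
  \<open>AVar 0\<close>), of the precondition axiom of \<open>A(x,e)\<close> and of the agent precondition of \<open>A(x)\<close>.
\<close>

record ('n, 'F, 'A) action_theory =
  acts :: "'A set"
  aar :: "'A \<Rightarrow> nat"
  flus :: "'F set"
  far :: "'F \<Rightarrow> nat"
  init :: "('n, 'F, 'A) ufm set"
  ssa :: "'F \<Rightarrow> ('n, 'F, 'A) ufm"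
  pre :: "'A \<Rightarrow> ('n, 'F, 'A) ufm"
  agpre :: "'A \<Rightarrow> ('n, 'F, 'A) ufm"

primrec wf_fm :: "('n::standard_names, 'F, 'A) action_theory \<Rightarrow> ('n, 'F) fm \<Rightarrow> ctx \<Rightarrow> bool" where
  "wf_fm D Tr n \<longleftrightarrow> True"
| "wf_fm D (Fl F ts) n \<longleftrightarrow> F \<in> flus D \<and> length ts = far D F \<and> (\<forall>t\<in>set ts. tm_in n t)"
| "wf_fm D (Eq t u) n \<longleftrightarrow> tm_in n t \<and> tm_in n u"
| "wf_fm D (Neg \<phi>) n \<longleftrightarrow> wf_fm D \<phi> n"
| "wf_fm D (Con \<phi> \<psi>) n \<longleftrightarrow> wf_fm D \<phi> n \<and> wf_fm D \<psi> n"
| "wf_fm D (Exi k \<phi>) n \<longleftrightarrow> wf_fm D \<phi> (n(k := Suc (n k)))"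

primrec wf_atm ::
  "('n::standard_names, 'F, 'A) action_theory \<Rightarrow> ctx \<Rightarrow> nat \<Rightarrow> ('n, 'A) atm \<Rightarrow> bool" where
  "wf_atm D n j (AVar i) \<longleftrightarrow> i < j"
| "wf_atm D n j (Act A ts t) \<longleftrightarrow>
     A \<in> acts D \<and> length ts = aar D A \<and> (\<forall>u\<in>set ts. tm_in n u) \<and> tm_in n t \<and> of_sort Reaction t"

primrec wf_ufm ::
  "('n::standard_names, 'F, 'A) action_theory \<Rightarrow> ('n, 'F, 'A) ufm \<Rightarrow> ctx \<Rightarrow> nat \<Rightarrow> bool" where
  "wf_ufm D (Sup \<phi>) n j \<longleftrightarrow> wf_fm D \<phi> n"
| "wf_ufm D (AEq a b) n j \<longleftrightarrow> wf_atm D n j a \<and> wf_atm D n j b"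
| "wf_ufm D (UNeg \<Phi>) n j \<longleftrightarrow> wf_ufm D \<Phi> n j"
| "wf_ufm D (UCon \<Phi> \<Psi>) n j \<longleftrightarrow> wf_ufm D \<Phi> n j \<and> wf_ufm D \<Psi> n j"
| "wf_ufm D (UEx k \<Phi>) n j \<longleftrightarrow> wf_ufm D \<Phi> (n(k := Suc (n k))) j"
| "wf_ufm D (UExA \<Phi>) n j \<longleftrightarrow> wf_ufm D \<Phi> n (Suc j)"

definition wf_theory :: "('n::standard_names, 'F, 'A) action_theory \<Rightarrow> bool" where
  "wf_theory D \<longleftrightarrow>
     finite (acts D) \<and> finite (flus D)
   \<and> (\<forall>\<Phi>\<in>init D. wf_ufm D \<Phi> (ctx 0 0) 0)
   \<and> (\<forall>F\<in>flus D. wf_ufm D (ssa D F) (ctx (far D F) 0) 1)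
   \<and> (\<forall>A\<in>acts D. wf_ufm D (pre D A) (ctx (aar D A) 1) 0)
   \<and> (\<forall>A\<in>acts D. wf_ufm D (agpre D A) (ctx (aar D A) 0) 0)"

definition foundational :: "('n, 'F, 'A, 'a, 's) struct \<Rightarrow> bool" where
  "foundational M \<longleftrightarrow>
     (\<forall>a a' s s'. doo M a s = doo M a' s' \<longrightarrow> a = a' \<and> s = s')
   \<and> (\<forall>P. P (S0 M) \<and> (\<forall>a s. P s \<longrightarrow> P (doo M a s)) \<longrightarrow> (\<forall>s. P s))
   \<and> (\<forall>s. \<not> prec M s (S0 M))
   \<and> (\<forall>a s s'. prec M s (doo M a s') \<longleftrightarrow> prec M s s' \<or> s = s')"

definition unique_names_actions ::
  "('n::standard_names, 'F, 'A, 'a, 's) struct \<Rightarrow> ('n, 'F, 'A) action_theory \<Rightarrow> bool" where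
  "unique_names_actions M D \<longleftrightarrow>
     (\<forall>A\<in>acts D. \<forall>A'\<in>acts D. \<forall>ds ds'. \<forall>e\<in>reactions. \<forall>e'\<in>reactions.
        length ds = aar D A \<longrightarrow> length ds' = aar D A' \<longrightarrow>
        actf M A ds e = actf M A' ds' e' \<longrightarrow> A = A' \<and> ds = ds' \<and> e = e')"

abbreviation sysact ::
  "('n, 'F, 'A, 'a, 's) struct \<Rightarrow> ('n, 'F, 'A) action_theory \<Rightarrow> 'n asg \<Rightarrow> 'A \<Rightarrow> 'a" where
  "sysact M D v A \<equiv> actf M A (map (val v) (xs_of (aar D A))) (val v e_of)"

definition models ::
  "('n::standard_names, 'F, 'A, 'a, 's) struct \<Rightarrow> ('n, 'F, 'A) action_theory \<Rightarrow> bool" where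
  "models M D \<longleftrightarrow>
     foundational M
   \<and> unique_names_actions M D
   \<and> (\<forall>\<Phi>\<in>init D. \<forall>v w. assignment v \<longrightarrow> usat M v w (S0 M) \<Phi>)
   \<and> (\<forall>F\<in>flus D. \<forall>v w s. assignment v \<longrightarrow>
        (flu M F (map (val v) (xs_of (far D F))) (doo M (w 0) s) \<longleftrightarrow> usat M v w s (ssa D F)))
   \<and> (\<forall>A\<in>acts D. \<forall>v w s. assignment v \<longrightarrow>
        (poss M (sysact M D v A) s \<longleftrightarrow> usat M v w s (pre D A)))"

text \<open>
  Entailment ranges over all structures with given action and situation domains, which are passed
  through the argument of type \<open>itself\<close>.
\<close>

definition ndbat ::
  "('a \<times> 's) itself \<Rightarrow> ('n::standard_names, 'F, 'A) action_theory \<Rightarrow> bool" where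
  "ndbat T D \<longleftrightarrow>
     wf_theory D
   \<and> (\<forall>M :: ('n, 'F, 'A, 'a, 's) struct. models M D \<longrightarrow>
        (\<forall>A\<in>acts D. \<forall>v w s. assignment v \<longrightarrow>
            (poss M (sysact M D v A) s \<longrightarrow> usat M v w s (agpre D A))
          \<and> (usat M v w s (agpre D A) \<longrightarrow>
               (\<exists>e\<in>reactions. poss M (actf M A (map (val v) (xs_of (aar D A))) e) s))))"


section \<open>ConGolog programs\<close>

text \<open>\<open>Sys A ts t\<close> is the system action \<open>A(ts,t)\<close>, \<open>Ag A ts\<close> the agent action \<open>A(ts)\<close>.\<close>

datatype ('n, 'A) atom = is_Sys: Sys 'A "'n tm list" "'n tm" | is_Ag: Ag 'A "'n tm list"

datatype ('n, 'F, 'A) prog =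
    Atom "('n, 'A) atom"
  | Test "('n, 'F) fm"
  | Seq "('n, 'F, 'A) prog" "('n, 'F, 'A) prog"
  | Choice "('n, 'F, 'A) prog" "('n, 'F, 'A) prog"
  | Pick srt "('n, 'F, 'A) prog"
  | Star "('n, 'F, 'A) prog"
  | Par "('n, 'F, 'A) prog" "('n, 'F, 'A) prog"

abbreviation nil :: "('n, 'F, 'A) prog" where
  "nil \<equiv> Test Tr"

primrec asubst :: "('n, 'A) atom \<Rightarrow> 'n sub \<Rightarrow> ('n, 'A) atom" where
  "asubst (Sys A ts t) \<sigma> = Sys A (map (tsubst \<sigma>) ts) (tsubst \<sigma> t)"
| "asubst (Ag A ts) \<sigma> = Ag A (map (tsubst \<sigma>) ts)"

primrec psubst :: "('n, 'F, 'A) prog \<Rightarrow> 'n sub \<Rightarrow> ('n, 'F, 'A) prog" where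
  "psubst (Atom \<alpha>) \<sigma> = Atom (asubst \<alpha> \<sigma>)"
| "psubst (Test \<phi>) \<sigma> = Test (fsubst \<phi> \<sigma>)"
| "psubst (Seq \<delta>\<^sub>1 \<delta>\<^sub>2) \<sigma> = Seq (psubst \<delta>\<^sub>1 \<sigma>) (psubst \<delta>\<^sub>2 \<sigma>)"
| "psubst (Choice \<delta>\<^sub>1 \<delta>\<^sub>2) \<sigma> = Choice (psubst \<delta>\<^sub>1 \<sigma>) (psubst \<delta>\<^sub>2 \<sigma>)"
| "psubst (Pick k \<delta>) \<sigma> = Pick k (psubst \<delta> (lift k \<sigma>))"
| "psubst (Star \<delta>) \<sigma> = Star (psubst \<delta> \<sigma>)"
| "psubst (Par \<delta>\<^sub>1 \<delta>\<^sub>2) \<sigma> = Par (psubst \<delta>\<^sub>1 \<sigma>) (psubst \<delta>\<^sub>2 \<sigma>)"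

primrec wf_atom ::
  "('n::standard_names, 'F, 'A) action_theory \<Rightarrow> ctx \<Rightarrow> ('n, 'A) atom \<Rightarrow> bool" where
  "wf_atom D n (Sys A ts t) \<longleftrightarrow>
     A \<in> acts D \<and> length ts = aar D A \<and> (\<forall>u\<in>set ts. tm_in n u) \<and> tm_in n t \<and> of_sort Reaction t"
| "wf_atom D n (Ag A ts) \<longleftrightarrow> A \<in> acts D \<and> length ts = aar D A \<and> (\<forall>u\<in>set ts. tm_in n u)"

text \<open>
  \<open>P\<close> restricts the atoms: \<open>is_Ag\<close> gives the agent programs, \<open>is_Sys\<close> the system programs.
\<close>

primrec wf_prog ::
  "('n::standard_names, 'F, 'A) action_theory \<Rightarrow> (('n, 'A) atom \<Rightarrow> bool) \<Rightarrow> ('n, 'F, 'A) prog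
     \<Rightarrow> ctx \<Rightarrow> bool" where
  "wf_prog D P (Atom \<alpha>) n \<longleftrightarrow> P \<alpha> \<and> wf_atom D n \<alpha>"
| "wf_prog D P (Test \<phi>) n \<longleftrightarrow> wf_fm D \<phi> n"
| "wf_prog D P (Seq \<delta>\<^sub>1 \<delta>\<^sub>2) n \<longleftrightarrow> wf_prog D P \<delta>\<^sub>1 n \<and> wf_prog D P \<delta>\<^sub>2 n"
| "wf_prog D P (Choice \<delta>\<^sub>1 \<delta>\<^sub>2) n \<longleftrightarrow> wf_prog D P \<delta>\<^sub>1 n \<and> wf_prog D P \<delta>\<^sub>2 n"
| "wf_prog D P (Pick k \<delta>) n \<longleftrightarrow> wf_prog D P \<delta> (n(k := Suc (n k)))"
| "wf_prog D P (Star \<delta>) n \<longleftrightarrow> wf_prog D P \<delta> n"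
| "wf_prog D P (Par \<delta>\<^sub>1 \<delta>\<^sub>2) n \<longleftrightarrow> wf_prog D P \<delta>\<^sub>1 n \<and> wf_prog D P \<delta>\<^sub>2 n"

text \<open>
  The axioms for Trans and Final determine these predicates by recursion on the size of the program;
  the lemmas below recover the axioms.
\<close>

inductive Final ::
  "('n::standard_names, 'F, 'A, 'a, 's) struct \<Rightarrow> 'n asg \<Rightarrow> ('n, 'F, 'A) prog \<Rightarrow> 's \<Rightarrow> bool"
  for M v where
  "sat M v s \<phi> \<Longrightarrow> Final M v (Test \<phi>) s"
| "Final M v \<delta>\<^sub>1 s \<Longrightarrow> Final M v \<delta>\<^sub>2 s \<Longrightarrow> Final M v (Seq \<delta>\<^sub>1 \<delta>\<^sub>2) s"
| "Final M v \<delta>\<^sub>1 s \<Longrightarrow> Final M v (Choice \<delta>\<^sub>1 \<delta>\<^sub>2) s"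
| "Final M v \<delta>\<^sub>2 s \<Longrightarrow> Final M v (Choice \<delta>\<^sub>1 \<delta>\<^sub>2) s"
| "d \<in> dom_of k \<Longrightarrow> Final M v (psubst \<delta> (inst k d)) s \<Longrightarrow> Final M v (Pick k \<delta>) s"
| "Final M v (Star \<delta>) s"
| "Final M v \<delta>\<^sub>1 s \<Longrightarrow> Final M v \<delta>\<^sub>2 s \<Longrightarrow> Final M v (Par \<delta>\<^sub>1 \<delta>\<^sub>2) s"

inductive Trans ::
  "('n::standard_names, 'F, 'A, 'a, 's) struct \<Rightarrow> 'n asg \<Rightarrow> ('n, 'F, 'A) prog \<Rightarrow> 's
     \<Rightarrow> ('n, 'F, 'A) prog \<Rightarrow> 's \<Rightarrow> bool"
  for M v where
  "a = actf M A (map (val v) ts) (val v t) \<Longrightarrow> poss M a s \<Longrightarrow>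
     Trans M v (Atom (Sys A ts t)) s nil (doo M a s)"
| "e \<in> reactions \<Longrightarrow> a = actf M A (map (val v) ts) e \<Longrightarrow> poss M a s \<Longrightarrow>
     Trans M v (Atom (Ag A ts)) s nil (doo M a s)"
| "Trans M v \<delta>\<^sub>1 s \<delta>\<^sub>1' s' \<Longrightarrow> Trans M v (Seq \<delta>\<^sub>1 \<delta>\<^sub>2) s (Seq \<delta>\<^sub>1' \<delta>\<^sub>2) s'"
| "Final M v \<delta>\<^sub>1 s \<Longrightarrow> Trans M v \<delta>\<^sub>2 s \<delta>' s' \<Longrightarrow> Trans M v (Seq \<delta>\<^sub>1 \<delta>\<^sub>2) s \<delta>' s'"
| "Trans M v \<delta>\<^sub>1 s \<delta>' s' \<Longrightarrow> Trans M v (Choice \<delta>\<^sub>1 \<delta>\<^sub>2) s \<delta>' s'"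
| "Trans M v \<delta>\<^sub>2 s \<delta>' s' \<Longrightarrow> Trans M v (Choice \<delta>\<^sub>1 \<delta>\<^sub>2) s \<delta>' s'"
| "d \<in> dom_of k \<Longrightarrow> Trans M v (psubst \<delta> (inst k d)) s \<delta>' s' \<Longrightarrow> Trans M v (Pick k \<delta>) s \<delta>' s'"
| "Trans M v \<delta> s \<delta>'' s' \<Longrightarrow> Trans M v (Star \<delta>) s (Seq \<delta>'' (Star \<delta>)) s'"
| "Trans M v \<delta>\<^sub>1 s \<delta>\<^sub>1' s' \<Longrightarrow> Trans M v (Par \<delta>\<^sub>1 \<delta>\<^sub>2) s (Par \<delta>\<^sub>1' \<delta>\<^sub>2) s'"
| "Trans M v \<delta>\<^sub>2 s \<delta>\<^sub>2' s' \<Longrightarrow> Trans M v (Par \<delta>\<^sub>1 \<delta>\<^sub>2) s (Par \<delta>\<^sub>1 \<delta>\<^sub>2') s'"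

lemma Final_axioms:
  "Final M v (Atom \<alpha>) s \<longleftrightarrow> False"
  "Final M v (Test \<phi>) s \<longleftrightarrow> sat M v s \<phi>"
  "Final M v (Seq \<delta>\<^sub>1 \<delta>\<^sub>2) s \<longleftrightarrow> Final M v \<delta>\<^sub>1 s \<and> Final M v \<delta>\<^sub>2 s"
  "Final M v (Choice \<delta>\<^sub>1 \<delta>\<^sub>2) s \<longleftrightarrow> Final M v \<delta>\<^sub>1 s \<or> Final M v \<delta>\<^sub>2 s"
  "Final M v (Pick k \<delta>) s \<longleftrightarrow> (\<exists>d\<in>dom_of k. Final M v (psubst \<delta> (inst k d)) s)"
  "Final M v (Star \<delta>) s \<longleftrightarrow> True"
  "Final M v (Par \<delta>\<^sub>1 \<delta>\<^sub>2) s \<longleftrightarrow> Final M v \<delta>\<^sub>1 s \<and> Final M v \<delta>\<^sub>2 s"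
  by (subst Final.simps; auto)+

lemma Trans_axioms:
  "Trans M v (Atom (Sys A ts t)) s \<delta>' s' \<longleftrightarrow>
     (let a = actf M A (map (val v) ts) (val v t) in s' = doo M a s \<and> poss M a s \<and> \<delta>' = nil)"
  "Trans M v (Atom (Ag A ts)) s \<delta>' s' \<longleftrightarrow>
     (\<exists>e\<in>reactions. let a = actf M A (map (val v) ts) e in poss M a s \<and> \<delta>' = nil \<and> s' = doo M a s)"
  "Trans M v (Test \<phi>) s \<delta>' s' \<longleftrightarrow> False"
  "Trans M v (Seq \<delta>\<^sub>1 \<delta>\<^sub>2) s \<delta>' s' \<longleftrightarrow>
     (\<exists>\<delta>\<^sub>1'. Trans M v \<delta>\<^sub>1 s \<delta>\<^sub>1' s' \<and> \<delta>' = Seq \<delta>\<^sub>1' \<delta>\<^sub>2) \<or> Final M v \<delta>\<^sub>1 s \<and> Trans M v \<delta>\<^sub>2 s \<delta>' s'"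
  "Trans M v (Choice \<delta>\<^sub>1 \<delta>\<^sub>2) s \<delta>' s' \<longleftrightarrow> Trans M v \<delta>\<^sub>1 s \<delta>' s' \<or> Trans M v \<delta>\<^sub>2 s \<delta>' s'"
  "Trans M v (Pick k \<delta>) s \<delta>' s' \<longleftrightarrow> (\<exists>d\<in>dom_of k. Trans M v (psubst \<delta> (inst k d)) s \<delta>' s')"
  "Trans M v (Star \<delta>) s \<delta>' s' \<longleftrightarrow> (\<exists>\<delta>''. Trans M v \<delta> s \<delta>'' s' \<and> \<delta>' = Seq \<delta>'' (Star \<delta>))"
  "Trans M v (Par \<delta>\<^sub>1 \<delta>\<^sub>2) s \<delta>' s' \<longleftrightarrow>
     (\<exists>\<delta>\<^sub>1'. Trans M v \<delta>\<^sub>1 s \<delta>\<^sub>1' s' \<and> \<delta>' = Par \<delta>\<^sub>1' \<delta>\<^sub>2)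
   \<or> (\<exists>\<delta>\<^sub>2'. Trans M v \<delta>\<^sub>2 s \<delta>\<^sub>2' s' \<and> \<delta>' = Par \<delta>\<^sub>1 \<delta>\<^sub>2')"
  by (subst Trans.simps; auto simp: Let_def)+

text \<open>
  Programs are reified, so the value of a program under \<open>v\<close> has the values of its free variables in
  place of these variables. Substituting them first makes equality of the remaining programs (which
  matters for situation-determinedness) equality of values.
\<close>

definition Trans_star ::
  "('n::standard_names, 'F, 'A, 'a, 's) struct \<Rightarrow> 'n asg \<Rightarrow> ('n, 'F, 'A) prog \<Rightarrow> 's
     \<Rightarrow> ('n, 'F, 'A) prog \<Rightarrow> 's \<Rightarrow> bool" where
  "Trans_star M v \<delta> s \<delta>' s' \<longleftrightarrow>
     (\<lambda>(\<gamma>, u) (\<gamma>', u'). Trans M v \<gamma> u \<gamma>' u')\<^sup>*\<^sup>* (psubst \<delta> (\<lambda>k i. Cst (v k i)), s) (\<delta>', s')"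

text \<open>
  \<open>Do M v \<delta> s s'\<close> is \<open>Do(\<delta>,s,s')\<close> for a system program \<open>\<delta>\<close> and \<open>Do\<^sub>a\<^sub>g(\<delta>,s,s')\<close> for an agent
  program \<open>\<delta>\<close>.
\<close>

definition Do ::
  "('n::standard_names, 'F, 'A, 'a, 's) struct \<Rightarrow> 'n asg \<Rightarrow> ('n, 'F, 'A) prog \<Rightarrow> 's \<Rightarrow> 's \<Rightarrow> bool" where
  "Do M v \<delta> s s' \<longleftrightarrow> (\<exists>\<delta>'. Trans_star M v \<delta> s \<delta>' s' \<and> Final M v \<delta>' s')"

definition situation_determined ::
  "('n::standard_names, 'F, 'A, 'a, 's) struct \<Rightarrow> 'n asg \<Rightarrow> ('n, 'F, 'A) prog \<Rightarrow> 's \<Rightarrow> bool" where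
  "situation_determined M v \<delta> s \<longleftrightarrow>
     (\<forall>\<delta>' \<delta>'' s'. Trans_star M v \<delta> s \<delta>' s' \<and> Trans_star M v \<delta> s \<delta>'' s' \<longrightarrow> \<delta>' = \<delta>'')"

type_synonym ('n, 'A) agent_seq = "('A \<times> 'n tm list) list"
type_synonym ('n, 'A) system_seq = "('A \<times> 'n tm list \<times> 'n tm) list"

definition wf_agent_seq ::
  "('n::standard_names, 'F, 'A) action_theory \<Rightarrow> ('n, 'A) agent_seq \<Rightarrow> bool" where
  "wf_agent_seq D \<alpha> \<longleftrightarrow> (\<forall>(A, ts)\<in>set \<alpha>. A \<in> acts D \<and> length ts = aar D A)"

definition wf_system_seq ::
  "('n::standard_names, 'F, 'A) action_theory \<Rightarrow> ('n, 'A) system_seq \<Rightarrow> bool" where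
  "wf_system_seq D \<alpha> \<longleftrightarrow>
     (\<forall>(A, ts, t)\<in>set \<alpha>. A \<in> acts D \<and> length ts = aar D A \<and> of_sort Reaction t)"

fun Do_ag ::
  "('n::standard_names, 'F, 'A, 'a, 's) struct \<Rightarrow> 'n asg \<Rightarrow> ('n, 'A) agent_seq \<Rightarrow> 's \<Rightarrow> 's \<Rightarrow> bool" where
  "Do_ag M v [] s s' \<longleftrightarrow> s' = s"
| "Do_ag M v ((A, ts) # \<alpha>) s s' \<longleftrightarrow>
     (\<exists>e\<in>reactions. let a = actf M A (map (val v) ts) e in
        poss M a s \<and> Do_ag M v \<alpha> (doo M a s) s')"


section \<open>Refinement mappings and bisimulation\<close>

record ('n, 'Fh, 'Ah, 'Fl, 'Al) refinement =
  ma :: "'Ah \<Rightarrow> ('n, 'Fl, 'Al) prog"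
  ms :: "'Ah \<Rightarrow> ('n, 'Fl, 'Al) prog"
  mf :: "'Fh \<Rightarrow> ('n, 'Fl) fm"

definition refinement_mapping ::
  "('a \<times> 's) itself \<Rightarrow> ('n::standard_names, 'Fh, 'Ah) action_theory
     \<Rightarrow> ('n, 'Fl, 'Al) action_theory \<Rightarrow> ('n, 'Fh, 'Ah, 'Fl, 'Al) refinement \<Rightarrow> bool" where
  "refinement_mapping T Dh Dl m \<longleftrightarrow>
     (\<forall>A\<in>acts Dh. wf_prog Dl is_Ag (ma m A) (ctx (aar Dh A) 0)
                \<and> wf_prog Dl is_Sys (ms m A) (ctx (aar Dh A) 1))
   \<and> (\<forall>F\<in>flus Dh. wf_fm Dl (mf m F) (ctx (far Dh F) 0))
   \<and> (\<forall>M :: ('n, 'Fl, 'Al, 'a, 's) struct. models M Dl \<longrightarrow>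
        (\<forall>A\<in>acts Dh. \<forall>v s. assignment v \<longrightarrow>
           situation_determined M v (ma m A) s \<and> situation_determined M v (ms m A) s))"

fun seq_all :: "('n, 'F, 'A) prog list \<Rightarrow> ('n, 'F, 'A) prog" where
  "seq_all [] = nil"
| "seq_all [\<delta>] = \<delta>"
| "seq_all (\<delta> # \<delta>' # \<delta>s) = Seq \<delta> (seq_all (\<delta>' # \<delta>s))"

definition ma_seq ::
  "('n, 'Fh, 'Ah, 'Fl, 'Al) refinement \<Rightarrow> ('n, 'Ah) agent_seq \<Rightarrow> ('n, 'Fl, 'Al) prog" where
  "ma_seq m \<alpha> = seq_all (map (\<lambda>(A, ts). psubst (ma m A) (args ts [])) \<alpha>)"

definition ms_seq ::
  "('n, 'Fh, 'Ah, 'Fl, 'Al) refinement \<Rightarrow> ('n, 'Ah) system_seq \<Rightarrow> ('n, 'Fl, 'Al) prog" where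
  "ms_seq m \<alpha> = seq_all (map (\<lambda>(A, ts, t). psubst (ms m A) (args ts [t])) \<alpha>)"

primrec mf_fm ::
  "('n, 'Fh, 'Ah, 'Fl, 'Al) refinement \<Rightarrow> ('n, 'Fh) fm \<Rightarrow> ('n, 'Fl) fm" where
  "mf_fm m Tr = Tr"
| "mf_fm m (Fl F ts) = fsubst (mf m F) (args ts [])"
| "mf_fm m (Eq t u) = Eq t u"
| "mf_fm m (Neg \<phi>) = Neg (mf_fm m \<phi>)"
| "mf_fm m (Con \<phi> \<psi>) = Con (mf_fm m \<phi>) (mf_fm m \<psi>)"
| "mf_fm m (Exi k \<phi>) = Exi k (mf_fm m \<phi>)"

text \<open>
  The assignment \<open>v\<close> below interprets the free variables of \<open>\<alpha>\<close>, and \<open>u\<close> the variables \<open>x\<close>, which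
  are quantified separately.
\<close>

definition proper ::
  "('a \<times> 's) itself \<Rightarrow> ('n::standard_names, 'Fh, 'Ah) action_theory
     \<Rightarrow> ('n, 'Fl, 'Al) action_theory \<Rightarrow> ('n, 'Fh, 'Ah, 'Fl, 'Al) refinement \<Rightarrow> bool" where
  "proper T Dh Dl m \<longleftrightarrow>
     (\<forall>\<alpha>. \<forall>A\<in>acts Dh. wf_system_seq Dh \<alpha> \<longrightarrow>
        (\<forall>M :: ('n, 'Fl, 'Al, 'a, 's) struct. models M Dl \<longrightarrow>
           (\<forall>v s. assignment v \<and> Do M v (ms_seq m \<alpha>) (S0 M) s \<longrightarrow>
              (\<forall>u s'. assignment u \<longrightarrow>
                 (Do M u (ma m A) s s' \<longleftrightarrow>
                    (\<exists>e\<in>reactions. Do M (u(Reaction := (u Reaction)(0 := e))) (ms m A) s s'))))))"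

definition m_isomorphic ::
  "('n::standard_names, 'Fh, 'Ah) action_theory \<Rightarrow> ('n, 'Fh, 'Ah, 'Fl, 'Al) refinement
     \<Rightarrow> ('n, 'Fh, 'Ah, 'ah, 'sh) struct \<Rightarrow> ('n, 'Fl, 'Al, 'al, 'sl) struct
     \<Rightarrow> 'sh \<Rightarrow> 'sl \<Rightarrow> bool" where
  "m_isomorphic Dh m Mh Ml sh sl \<longleftrightarrow>
     (\<forall>F\<in>flus Dh. \<forall>v. assignment v \<longrightarrow>
        (sat Mh v sh (Fl F (xs_of (far Dh F))) \<longleftrightarrow> sat Ml v sl (mf m F)))"

definition m_bisimulation ::
  "('n::standard_names, 'Fh, 'Ah) action_theory \<Rightarrow> ('n, 'Fh, 'Ah, 'Fl, 'Al) refinement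
     \<Rightarrow> ('n, 'Fh, 'Ah, 'ah, 'sh) struct \<Rightarrow> ('n, 'Fl, 'Al, 'al, 'sl) struct
     \<Rightarrow> ('sh \<times> 'sl) set \<Rightarrow> bool" where
  "m_bisimulation Dh m Mh Ml B \<longleftrightarrow>
     (\<forall>(sh, sl)\<in>B.
        m_isomorphic Dh m Mh Ml sh sl
      \<and> (\<forall>A\<in>acts Dh. \<forall>v sh'. assignment v \<longrightarrow>
           poss Mh (sysact Mh Dh v A) sh \<and> sh' = doo Mh (sysact Mh Dh v A) sh \<longrightarrow>
           (\<exists>sl'. Do Ml v (ms m A) sl sl' \<and> (sh', sl') \<in> B))
      \<and> (\<forall>A\<in>acts Dh. \<forall>v sl'. assignment v \<longrightarrow>
           Do Ml v (ms m A) sl sl' \<longrightarrow>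
           (\<exists>sh'. poss Mh (sysact Mh Dh v A) sh \<and> sh' = doo Mh (sysact Mh Dh v A) sh
                \<and> (sh', sl') \<in> B)))"

definition m_bisimilar ::
  "('n::standard_names, 'Fh, 'Ah) action_theory \<Rightarrow> ('n, 'Fh, 'Ah, 'Fl, 'Al) refinement
     \<Rightarrow> ('n, 'Fh, 'Ah, 'ah, 'sh) struct \<Rightarrow> ('n, 'Fl, 'Al, 'al, 'sl) struct \<Rightarrow> bool" where
  "m_bisimilar Dh m Mh Ml \<longleftrightarrow> (\<exists>B. m_bisimulation Dh m Mh Ml B \<and> (S0 Mh, S0 Ml) \<in> B)"

end

theory Submission
  imports Defs
begin

text \<open>
  Properness says that, at a low-level situation reached by refining some system action sequence, an
  execution of \<open>m\<^sub>a(A(x))\<close> is an execution of \<open>m\<^sub>s(A(x,e))\<close> for some reaction \<open>e\<close>, just as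
  executing the high-level agent action \<open>A(x)\<close> is executing \<open>A(x,e)\<close> for some \<open>e\<close>. Hence a pair of
  bisimilar situations, the lower one being so reached, can be carried along the agent action sequence
  one action at a time; at its end, bisimilar situations agree on \<open>\<phi>\<close> and its image.
\<close>

section \<open>Substitution\<close>

definition scomp :: "'n sub \<Rightarrow> 'n sub \<Rightarrow> 'n sub" where
  "scomp \<sigma> \<tau> = (\<lambda>k i. tsubst \<tau> (\<sigma> k i))"

lemma tsubst_tsubst: "tsubst \<tau> (tsubst \<sigma> t) = tsubst (scomp \<sigma> \<tau>) t"
  by (cases t) (simp_all add: scomp_def)

lemma tsubst_lift_shift: "tsubst (lift k \<tau>) (shift k t) = shift k (tsubst \<tau> t)"
  by (cases t) (auto simp: shift_def lift_def Let_def)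

lemma scomp_lift: "scomp (lift k \<sigma>) (lift k \<tau>) = lift k (scomp \<sigma> \<tau>)"
proof (intro ext)
  fix k' i
  show "scomp (lift k \<sigma>) (lift k \<tau>) k' i = lift k (scomp \<sigma> \<tau>) k' i"
    using tsubst_lift_shift[of k \<tau>]
    by (cases i) (auto simp: scomp_def lift_def Let_def)
qed

lemma tsubst_inst_shift: "tsubst (inst k d) (shift k t) = t"
  by (cases t) (auto simp: shift_def inst_def)

text \<open>Both sides send the innermost variable to \<open>Cst d\<close>, which no substitution
  changes. For the other variables of sort \<open>k\<close>, \<open>inst\<close> undoes the shift
  made by \<open>lift\<close>.\<close>

lemma scomp_lift_inst: "scomp (lift k \<sigma>) (inst k d) = scomp (inst k d) \<sigma>"
proof (intro ext)
  fix k' i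
  show "scomp (lift k \<sigma>) (inst k d) k' i = scomp (inst k d) \<sigma> k' i"
  proof (cases "k' = k")
    case True
    then show ?thesis
      using tsubst_inst_shift[of k d]
      by (cases i) (auto simp: scomp_def lift_def Let_def, auto simp: inst_def)
  next
    case False
    then show ?thesis
      using tsubst_inst_shift[of k d]
      by (auto simp: scomp_def lift_def Let_def, auto simp: inst_def)
  qed
qed

lemma fsubst_fsubst: "fsubst (fsubst \<phi> \<sigma>) \<tau> = fsubst \<phi> (scomp \<sigma> \<tau>)"
  by (induction \<phi> arbitrary: \<sigma> \<tau>) (simp_all add: tsubst_tsubst scomp_lift)

lemma psubst_psubst: "psubst (psubst \<delta> \<sigma>) \<tau> = psubst \<delta> (scomp \<sigma> \<tau>)"
proof (induction \<delta> arbitrary: \<sigma> \<tau>)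
  case (Atom \<alpha>)
  then show ?case by (cases \<alpha>) (simp_all add: tsubst_tsubst)
qed (simp_all add: fsubst_fsubst scomp_lift)

text \<open>The semantic counterpart of a substitution: evaluating under
  \<open>vcomp v \<sigma>\<close> replaces substituting \<sigma> and evaluating under
  \<open>v\<close>.\<close>

definition vcomp :: "'n asg \<Rightarrow> 'n sub \<Rightarrow> 'n asg" where
  "vcomp v \<sigma> = (\<lambda>k i. val v (\<sigma> k i))"

lemma val_tsubst: "val v (tsubst \<sigma> t) = val (vcomp v \<sigma>) t"
  by (cases t) (simp_all add: vcomp_def)

lemma val_push_shift: "val (push k d v) (shift k t) = val v t"
  by (cases t) (auto simp: shift_def push_def)

lemma vcomp_push_lift: "vcomp (push k d v) (lift k \<sigma>) = push k d (vcomp v \<sigma>)"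
proof (intro ext)
  fix k' i
  show "vcomp (push k d v) (lift k \<sigma>) k' i = push k d (vcomp v \<sigma>) k' i"
    using val_push_shift[of k d v]
    by (cases i; cases "k' = k") (auto simp: vcomp_def lift_def Let_def, auto simp: push_def)
qed

lemma sat_fsubst: "sat M v s (fsubst \<phi> \<sigma>) \<longleftrightarrow> sat M (vcomp v \<sigma>) s \<phi>"
  by (induction \<phi> arbitrary: v \<sigma>) (simp_all add: val_tsubst vcomp_push_lift comp_def)

abbreviation cst :: "'n asg \<Rightarrow> 'n sub" where
  "cst v \<equiv> \<lambda>k i. Cst (v k i)"

lemma vcomp_cst: "vcomp v (cst u) = u"
  by (simp add: vcomp_def)

lemma scomp_cst: "scomp (cst v) \<sigma> = cst v"
  by (simp add: scomp_def)

lemma tsubst_cst: "tsubst (cst v) t = Cst (val v t)"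
  by (cases t) simp_all

lemma scomp_to_cst: "scomp \<sigma> (cst v) = cst (vcomp v \<sigma>)"
  by (simp add: scomp_def vcomp_def tsubst_cst)


section \<open>Ground programs\<close>

text \<open>Invariance under every substitution stands in for having no free variables. Since
  \<open>lift\<close> protects the bound ones, no context has to be tracked.\<close>

definition ground :: "('n, 'F, 'A) prog \<Rightarrow> bool" where
  "ground \<delta> \<longleftrightarrow> (\<forall>\<sigma>. psubst \<delta> \<sigma> = \<delta>)"

lemma ground_simps [simp]:
  "ground nil"
  "ground (Seq \<delta> \<delta>') \<longleftrightarrow> ground \<delta> \<and> ground \<delta>'"
  "ground (Choice \<delta> \<delta>') \<longleftrightarrow> ground \<delta> \<and> ground \<delta>'"
  "ground (Star \<delta>) \<longleftrightarrow> ground \<delta>"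
  "ground (Par \<delta> \<delta>') \<longleftrightarrow> ground \<delta> \<and> ground \<delta>'"
  by (auto simp: ground_def)

text \<open>Groundness of a \<open>Pick\<close> makes its body invariant only under lifted
  substitutions. This suffices, since a substitution applied after \<open>inst\<close> can be moved
  before it in lifted form.\<close>

lemma ground_inst:
  assumes "ground (Pick k \<delta>)"
  shows "ground (psubst \<delta> (inst k d))"
  unfolding ground_def
proof
  fix \<sigma>
  have "psubst (psubst \<delta> (inst k d)) \<sigma> = psubst (psubst \<delta> (lift k \<sigma>)) (inst k d)"
    by (simp add: psubst_psubst scomp_lift_inst)
  also have "psubst \<delta> (lift k \<sigma>) = \<delta>"
    using assms by (simp add: ground_def)
  finally show "psubst (psubst \<delta> (inst k d)) \<sigma> = psubst \<delta> (inst k d)" .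
qed

lemma ground_psubst_cst: "ground (psubst \<delta> (cst v))"
  by (simp add: ground_def psubst_psubst scomp_cst)

text \<open>Substituting \<open>cst u\<close> leaves \<open>t\<close> unchanged but also turns it
  into \<open>Cst (val u t)\<close>, whose value is the same under every assignment.\<close>

lemma val_ground:
  assumes "\<And>\<sigma>. tsubst \<sigma> t = t"
  shows "val v t = val u t"
  by (metis assms tsubst_cst val.simps(2))

lemma map_val_ground:
  assumes "\<And>\<sigma>. map (tsubst \<sigma>) ts = ts"
  shows "map (val v) ts = map (val u) ts"
proof -
  have "map (val v) (map (tsubst (cst u)) ts) = map (val u) ts"
    by (simp add: tsubst_cst comp_def)
  then show ?thesis by (simp only: assms)
qed

lemma sat_ground:
  assumes "ground (Test \<phi>)"
  shows "sat M v s \<phi> \<longleftrightarrow> sat M u s \<phi>"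
proof -
  have "fsubst \<phi> (cst u) = \<phi>" using assms by (simp add: ground_def)
  then show ?thesis using sat_fsubst[of M v s \<phi> "cst u"] by (simp add: vcomp_cst)
qed

lemma Final_ground:
  assumes "Final M v \<delta> s" "ground \<delta>"
  shows "Final M u \<delta> s"
  using assms
  by (induction rule: Final.induct)
    (auto intro: Final.intros ground_inst simp: Final_axioms sat_ground[where v = v and u = u])

text \<open>\<open>Trans\<close> consults the assignment only to evaluate terms and tests.
  Groundness of the remaining program is proved along with this, so that the argument can be
  iterated over a whole execution.\<close>

lemma Trans_ground:
  assumes "Trans M v \<delta> s \<delta>' s'" "ground \<delta>"
  shows "Trans M u \<delta> s \<delta>' s' \<and> ground \<delta>'"
  using assms
proof (induction rule: Trans.induct)
  case (1 a A ts t s)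
  then have "map (val v) ts = map (val u) ts" "val v t = val u t"
    by (auto simp: ground_def intro!: map_val_ground val_ground simp del: map_eq_conv)
  with 1 show ?case by (auto simp: Trans_axioms Let_def)
next
  case (2 e a A ts s)
  then have "map (val v) ts = map (val u) ts"
    by (auto simp: ground_def intro!: map_val_ground simp del: map_eq_conv)
  with 2 show ?case by (auto simp: Trans_axioms Let_def simp del: map_eq_conv)
next
  case (7 d k \<delta> s \<delta>' s')
  then show ?case by (auto intro: Trans.intros ground_inst)
qed (auto intro: Trans.intros Final_ground)


section \<open>Executions\<close>

text \<open>Complete executions as one inductive predicate. Unlike \<open>Trans_star\<close>, it
  hides the remaining program and performs no initial substitution, so it supports induction along
  an execution.\<close>

inductive run ::
  "('n::standard_names, 'F, 'A, 'a, 's) struct \<Rightarrow> 'n asg \<Rightarrow> ('n, 'F, 'A) prog \<Rightarrow> 's \<Rightarrow> 's \<Rightarrow> bool"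
  for M v where
  stop: "Final M v \<delta> s \<Longrightarrow> run M v \<delta> s s"
| step: "Trans M v \<delta> s \<delta>' s' \<Longrightarrow> run M v \<delta>' s' s'' \<Longrightarrow> run M v \<delta> s s''"

lemma Do_iff_run: "Do M v \<delta> s s' \<longleftrightarrow> run M v (psubst \<delta> (cst v)) s s'"
proof -
  let ?T = "\<lambda>(\<gamma>, u) (\<gamma>', u'). Trans M v \<gamma> u \<gamma>' u'"
  have "run M v \<gamma> s s'" if "?T\<^sup>*\<^sup>* (\<gamma>, s) (\<gamma>', s')" "Final M v \<gamma>' s'" for \<gamma> \<gamma>' s
    using that
    by (induction "(\<gamma>, s)" arbitrary: \<gamma> s rule: converse_rtranclp_induct) (auto intro: run.intros)
  moreover have "\<exists>\<gamma>'. ?T\<^sup>*\<^sup>* (\<gamma>, s) (\<gamma>', s') \<and> Final M v \<gamma>' s'" if "run M v \<gamma> s s'" for \<gamma> s s'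
    using that
  proof induction
    case (step \<delta> s \<delta>' s' s'')
    then obtain \<gamma>' where "?T\<^sup>*\<^sup>* (\<delta>', s') (\<gamma>', s'')" "Final M v \<gamma>' s''" by blast
    moreover have "?T (\<delta>, s) (\<delta>', s')" using step by simp
    ultimately show ?case by (blast intro: converse_rtranclp_into_rtranclp)
  qed blast
  ultimately show ?thesis unfolding Do_def Trans_star_def by blast
qed

lemma run_ground:
  assumes "run M v \<delta> s s'" "ground \<delta>"
  shows "run M u \<delta> s s'"
  using assms by induction (auto intro: run.intros Final_ground dest: Trans_ground[where u = u])

text \<open>Both sides run the same program, \<delta> with the values of
  \<open>vcomp v \<sigma>\<close> filled in. It is ground, so the differing assignments do not
  matter.\<close>

lemma Do_psubst: "Do M v (psubst \<delta> \<sigma>) s s' \<longleftrightarrow> Do M (vcomp v \<sigma>) \<delta> s s'"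
  unfolding Do_iff_run psubst_psubst scomp_to_cst
  by (rule iffI; erule run_ground; rule ground_psubst_cst)

lemma run_Seq: "run M v (Seq \<delta> \<delta>') s s' \<longleftrightarrow> (\<exists>r. run M v \<delta> s r \<and> run M v \<delta>' r s')"
proof
  show "\<exists>r. run M v \<delta> s r \<and> run M v \<delta>' r s'" if "run M v (Seq \<delta> \<delta>') s s'"
    using that
    \<comment> \<open>Only the first component is generalized: a step taken inside it leaves a
      \<open>Seq\<close> with the same second component.\<close>
    by (induction "Seq \<delta> \<delta>'" s s' arbitrary: \<delta>)
      (auto simp: Final_axioms Trans_axioms intro: run.intros, blast intro: run.intros)
next
  assume "\<exists>r. run M v \<delta> s r \<and> run M v \<delta>' r s'"
  then obtain r where "run M v \<delta> s r" "run M v \<delta>' r s'" by blast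
  then show "run M v (Seq \<delta> \<delta>') s s'"
  proof induction
    case (stop \<delta> s)
    \<comment> \<open>The case distinction is on the run of the second program: if it stops at once,
      the \<open>Seq\<close> is final; otherwise its first step is a step of the \<open>Seq\<close>,
      whose first component is final.\<close>
    from stop(2,1) show ?case
      by cases (auto intro: run.intros Final.intros Trans.intros)
  qed (blast intro: run.intros Trans.intros)
qed

lemma Do_Seq: "Do M v (Seq \<delta> \<delta>') s s' \<longleftrightarrow> (\<exists>r. Do M v \<delta> s r \<and> Do M v \<delta>' r s')"
  by (simp add: Do_iff_run run_Seq)

lemma Do_nil: "Do M v nil s s' \<longleftrightarrow> s' = s"
  unfolding Do_iff_run by (subst run.simps) (auto simp: Final_axioms Trans_axioms)

lemma Do_seq_all_Cons:
  "Do M v (seq_all (\<delta> # \<delta>s)) s s' \<longleftrightarrow> (\<exists>r. Do M v \<delta> s r \<and> Do M v (seq_all \<delta>s) r s')"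
  by (cases \<delta>s) (simp_all add: Do_nil Do_Seq)

text \<open>Needed because the system sequence that witnesses how a low-level situation was reached
  grows at its end.\<close>

lemma Do_seq_all_snoc:
  "Do M v (seq_all (\<delta>s @ [\<delta>])) s s' \<longleftrightarrow> (\<exists>r. Do M v (seq_all \<delta>s) s r \<and> Do M v \<delta> r s')"
  by (induction \<delta>s arbitrary: s) (auto simp: Do_nil Do_seq_all_Cons simp del: seq_all.simps(2-3))


section \<open>Instantiated parameters\<close>

lemma assignment_reaction: "assignment v \<Longrightarrow> v Reaction i \<in> reactions"
  unfolding assignment_def by (metis dom_of.simps(2))

lemma assignment_args:
  assumes "assignment v"
  shows "assignment (vcomp v (args ts []))"
  unfolding assignment_def
proof (intro allI)
  fix k i
  show "vcomp v (args ts []) k i \<in> dom_of k"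
    using assms by (cases k) (auto simp: assignment_reaction vcomp_def args_def)
qed

text \<open>Brings the assignment into the updated form in which \<open>proper\<close> quantifies
  over reactions.\<close>

lemma vcomp_args_reaction:
  "vcomp v (args ts [Cst e]) =
     (let u = vcomp v (args ts []) in u(Reaction := (u Reaction)(0 := e)))"
proof (intro ext)
  fix k i
  show "vcomp v (args ts [Cst e]) k i =
      (let u = vcomp v (args ts []) in u(Reaction := (u Reaction)(0 := e))) k i"
    by (cases k) (auto simp: vcomp_def args_def Let_def)
qed

lemma assignment_args_reaction:
  assumes "assignment v" "e \<in> reactions"
  shows "assignment (vcomp v (args ts [Cst e]))"
proof -
  let ?u = "vcomp v (args ts [])"
  have "\<forall>i. ?u Reaction i \<in> reactions"
    using assignment_args[OF assms(1)] by (blast intro: assignment_reaction)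
  then have "(?u(Reaction := (?u Reaction)(0 := e))) k i \<in> dom_of k" for k i
    using assms(2) by (cases k) auto
  then show ?thesis unfolding assignment_def vcomp_args_reaction Let_def by blast
qed

lemma map_val_xs_of: "map (val (vcomp v (args ts rs))) (xs_of (length ts)) = map (val v) ts"
  by (rule nth_equalityI) (simp_all add: xs_of_def vcomp_def args_def)

lemma val_e_of: "val (vcomp v (args ts [Cst e])) e_of = e"
  by (simp add: e_of_def vcomp_def args_def)


section \<open>Bisimilar situations\<close>

text \<open>At a fluent atom, the isomorphism is used with the formal parameters valued by the
  actual arguments. At a quantifier, the same witnesses serve both models because they share the
  domain of names.\<close>

lemma m_isomorphic_sat:
  assumes "m_isomorphic Dh m Mh Ml sh sl" "wf_fm Dh \<phi> n" "assignment v"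
  shows "sat Ml v sl (mf_fm m \<phi>) \<longleftrightarrow> sat Mh v sh \<phi>"
  using assms(2,3)
proof (induction \<phi> arbitrary: n v)
  case (Fl F ts)
  let ?u = "vcomp v (args ts [])"
  have "sat Mh ?u sh (Fl F (xs_of (far Dh F))) \<longleftrightarrow> sat Ml ?u sl (mf m F)"
    using assms(1) Fl assignment_args[of v ts] unfolding m_isomorphic_def by auto
  moreover have "map (val ?u) (xs_of (far Dh F)) = map (val v) ts"
    using Fl map_val_xs_of[of v ts "[]"] by simp
  ultimately show ?case by (simp add: sat_fsubst)
next
  case (Exi k \<phi>)
  have "assignment (push k d v)" if "d \<in> dom_of k" for d
    using that Exi.prems(2) by (auto simp: assignment_def push_def split: nat.split)
  then show ?case using Exi by auto
qed auto

lemma Do_ma_iff_ms: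
  fixes Ml :: "('n::standard_names, 'Fl, 'Al, 'al, 'sl) struct"
  assumes "proper TYPE('al \<times> 'sl) Dh Dl m" "models Ml Dl" "assignment v"
    and "wf_system_seq Dh \<beta>" "Do Ml v (ms_seq m \<beta>) (S0 Ml) s" "A \<in> acts Dh"
  shows "Do Ml v (psubst (ma m A) (args ts [])) s s' \<longleftrightarrow>
    (\<exists>e\<in>reactions. Do Ml v (psubst (ms m A) (args ts [Cst e])) s s')"
  using assms assignment_args[of v ts]
  unfolding proper_def Do_psubst vcomp_args_reaction Let_def by blast

text \<open>Generalizes from the initial situations to any bisimilar pair. The history \<beta> is
  carried along because properness speaks only about low-level situations reached by refining a
  system sequence.\<close>

lemma m_bisimulation_Do_iff:
  fixes Mh :: "('n::standard_names, 'Fh, 'Ah, 'ah, 'sh) struct"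
    and Ml :: "('n, 'Fl, 'Al, 'al, 'sl) struct"
  assumes proper: "proper TYPE('al \<times> 'sl) Dh Dl m" and mod: "models Ml Dl" and v: "assignment v"
    and bis: "m_bisimulation Dh m Mh Ml B" and wf_phi: "wf_fm Dh \<phi> n"
    and "(sh, sl) \<in> B" "wf_agent_seq Dh \<alpha>"
    and "wf_system_seq Dh \<beta>" "Do Ml v (ms_seq m \<beta>) (S0 Ml) sl"
  shows "(\<exists>s'. Do Ml v (ma_seq m \<alpha>) sl s' \<and> sat Ml v s' (mf_fm m \<phi>)) \<longleftrightarrow>
         (\<exists>s'. Do_ag Mh v \<alpha> sh s' \<and> sat Mh v s' \<phi>)"
  using assms(6-)
proof (induction \<alpha> arbitrary: sh sl \<beta>)
  case Nil
  then have "m_isomorphic Dh m Mh Ml sh sl"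
    using bis unfolding m_bisimulation_def by blast
  from m_isomorphic_sat[OF this wf_phi v] show ?case by (simp add: ma_seq_def Do_nil)
next
  case (Cons x \<alpha>)
  obtain A ts where x: "x = (A, ts)" by (cases x)
  have A: "A \<in> acts Dh" and len: "length ts = aar Dh A" and wf: "wf_agent_seq Dh \<alpha>"
    using Cons.prems(2) by (auto simp: wf_agent_seq_def x)
  let ?ms = "\<lambda>e. psubst (ms m A) (args ts [Cst e])"
  let ?a = "actf Mh A (map (val v) ts)"
  let ?L = "\<lambda>s. \<exists>s'. Do Ml v (ma_seq m \<alpha>) s s' \<and> sat Ml v s' (mf_fm m \<phi>)"
  let ?H = "\<lambda>s. \<exists>s'. Do_ag Mh v \<alpha> s s' \<and> sat Mh v s' \<phi>"
  \<comment> \<open>Every reaction is a standard name, so the one chosen can be recorded in the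
    history as the constant \<open>Cst e\<close>.\<close>
  have IH: "?L sl' \<longleftrightarrow> ?H sh'"
    if "(sh', sl') \<in> B" "e \<in> reactions" "Do Ml v (?ms e) sl sl'" for e sh' sl'
  proof (rule Cons.IH[OF that(1) wf])
    show "wf_system_seq Dh (\<beta> @ [(A, ts, Cst e)])"
      using Cons.prems(3) A len that(2) by (auto simp: wf_system_seq_def)
    show "Do Ml v (ms_seq m (\<beta> @ [(A, ts, Cst e)])) (S0 Ml) sl'"
      using Cons.prems(4) that(3) by (auto simp: ms_seq_def Do_seq_all_snoc)
  qed
  have act: "sysact Mh Dh (vcomp v (args ts [Cst e])) A = ?a e" for e
    using map_val_xs_of[of v ts "[Cst e]"] by (simp add: len val_e_of)
  have forward: "\<exists>sl'. Do Ml v (?ms e) sl sl' \<and> (doo Mh (?a e) sh, sl') \<in> B"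
    if "e \<in> reactions" "poss Mh (?a e) sh" for e
    using bis Cons.prems(1) A assignment_args_reaction[OF v that(1), of ts] that(2) act[of e]
    unfolding m_bisimulation_def Do_psubst by fastforce
  \<comment> \<open>The high-level successor provided by the bisimulation is determined by the
    action, so the related pair can be named explicitly.\<close>
  have backward: "poss Mh (?a e) sh \<and> (doo Mh (?a e) sh, sl') \<in> B"
    if "e \<in> reactions" "Do Ml v (?ms e) sl sl'" for e sl'
    using bis Cons.prems(1) A assignment_args_reaction[OF v that(1), of ts] that(2) act[of e]
    unfolding m_bisimulation_def Do_psubst by fastforce
  have "(\<exists>s'. Do Ml v (ma_seq m (x # \<alpha>)) sl s' \<and> sat Ml v s' (mf_fm m \<phi>)) \<longleftrightarrow>
      (\<exists>sl'. Do Ml v (psubst (ma m A) (args ts [])) sl sl' \<and> ?L sl')"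
    by (auto simp: ma_seq_def x Do_seq_all_Cons simp del: seq_all.simps(2-3))
  \<comment> \<open>Properness exposes the reaction hidden in the agent program; the bisimulation
    clauses, stated for system programs, then apply.\<close>
  also have "\<dots> \<longleftrightarrow> (\<exists>e\<in>reactions. \<exists>sl'. Do Ml v (?ms e) sl sl' \<and> ?L sl')"
    using Do_ma_iff_ms[OF proper mod v Cons.prems(3,4) A] by blast
  \<comment> \<open>From left to right \<open>backward\<close> supplies the related pair, from right
    to left \<open>forward\<close> does; in both, \<open>IH\<close> transfers the rest of the
    execution.\<close>
  also have "\<dots> \<longleftrightarrow> (\<exists>e\<in>reactions. poss Mh (?a e) sh \<and> ?H (doo Mh (?a e) sh))"
    using IH forward backward by meson
  also have "\<dots> \<longleftrightarrow> (\<exists>s'. Do_ag Mh v (x # \<alpha>) sh s' \<and> sat Mh v s' \<phi>)"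
    by (auto simp: x Let_def)
  finally show ?case .
qed

theorem theorem5:
  fixes Dh :: "('n::standard_names, 'Fh, 'Ah) action_theory"
    and Dl :: "('n, 'Fl, 'Al) action_theory"
    and m :: "('n, 'Fh, 'Ah, 'Fl, 'Al) refinement"
    and Mh :: "('n, 'Fh, 'Ah, 'ah, 'sh) struct"
    and Ml :: "('n, 'Fl, 'Al, 'al, 'sl) struct"
    and \<alpha> :: "('n, 'Ah) agent_seq"
    and \<phi> :: "('n, 'Fh) fm"
    and v :: "'n asg"
  assumes "ndbat TYPE('ah \<times> 'sh) Dh"
    and "ndbat TYPE('al \<times> 'sl) Dl"
    and "refinement_mapping TYPE('al \<times> 'sl) Dh Dl m"
    and "proper TYPE('al \<times> 'sl) Dh Dl m"
    and "models Mh Dh"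
    and "models Ml Dl"
    and "m_bisimilar Dh m Mh Ml"
    and "wf_agent_seq Dh \<alpha>"
    and "\<exists>n. wf_fm Dh \<phi> n"
    and "assignment v"
  shows "(\<exists>s'. Do Ml v (ma_seq m \<alpha>) (S0 Ml) s' \<and> sat Ml v s' (mf_fm m \<phi>)) \<longleftrightarrow>
         (\<exists>s'. Do_ag Mh v \<alpha> (S0 Mh) s' \<and> sat Mh v s' \<phi>)"
proof -
  obtain B where B: "m_bisimulation Dh m Mh Ml B" "(S0 Mh, S0 Ml) \<in> B"
    using assms(7) unfolding m_bisimilar_def by blast
  obtain n where n: "wf_fm Dh \<phi> n" using assms(9) by blast
  show ?thesis
    \<comment> \<open>The empty history refines to \<open>nil\<close>, which reaches exactly the
      initial situation.\<close>
    by (rule m_bisimulation_Do_iff[OF assms(4,6,10) B(1) n B(2) assms(8), of "[]"])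
      (simp_all add: wf_system_seq_def ms_seq_def Do_nil)
qed

end
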